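(* Let $\mathcal{E}$ be an exponential family defined over a finite set $\Omega=\{x_{1},\dots,x_{m}\}$ (with the counting measure), with elements of the form $p(x;\theta)=e^{C(x)+\langle \theta,F(x)\rangle-\psi(\theta)}$, where $\theta\in \mathbb{R}^{n}$, $C:\Omega\to \mathbb{R}$, $F=(F^{1},\dots,F^{n}):\Omega\to \mathbb{R}^{n}$, $\psi:\mathbb{R}^{n}\to \mathbb{R}$, and the functions $1,F^{1},\dots,F^{n}$ are linearly independent. If $F:\Omega\to \mathbb{R}^{n}$ is injective, then $\mathrm{Diff}(\mathcal{E},h_{F},\nabla^{(e)})=\mathrm{Perm}(\mathcal{E})$.
   Context: $\langle u,v\rangle=\sum u_iv_i$ is the Euclidean pairing. The elements of $\mathcal{E}$ are the probability functions $p_\theta=p(\cdot;\theta)$, $\theta\in\mathbb{R}^n$; the condition $\sum_{x\in\Omega}p(x;\theta)=1$ forces $\psi(\theta)=\ln\sum_{x\in\Omega}e^{C(x)+\langle\theta,F(x)\rangle}$. Since $1,F^1,\dots,F^n$ are linearly independent, $p_\theta\mapsto\theta$ is a bijection $\mathcal{E}\to\mathbb{R}^n$, which is used as a global chart making $\mathcal{E}$ a smooth manifold. The Fisher metric $h_{F}$ is $(h_{F})_{ij}(\theta)=\sum_{x}p_\theta(x)\,\partial_{i}\ln p_\theta(x)\,\partial_{j}\ln p_\theta(x)$ ($\partial_i=\partial/\partial\theta_i$), which equals $\partial^{2}\psi/\partial\theta_{i}\partial\theta_{j}$. The exponential connection $\nabla^{(e)}$ is given by $h_F(\nabla^{(e)}_{\partial_i}\partial_j,\partial_k)=\sum_x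 p_\theta(x)\,\partial_i\partial_j\ln p_\theta(x)\,\partial_k\ln p_\theta(x)$; it is the flat connection for which $\theta_1,\dots,\theta_n$ are affine coordinates. $\mathrm{Diff}(\mathcal{E},h_{F},\nabla^{(e)})$ is the group of isometries of $(\mathcal{E},h_{F})$ that are affine with respect to $\nabla^{(e)}$. A diffeomorphism $\varphi$ of $\mathcal{E}$ is a permutation if there is a permutation $\sigma$ of $\{1,\dots,m\}$ with $\varphi(p)(x_{i})=p(x_{\sigma(i)})$ for all $p\in\mathcal{E}$ and all $i$; $\mathrm{Perm}(\mathcal{E})$ is the group of permutations of $\mathcal{E}$. *)

theory Defs
  imports "HOL-Analysis.Analysis"
begin

section \<open>Calculus on \<open>\<real>\<^sup>n\<close>\<close>

definition partial_deriv ::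
  "'n::finite \<Rightarrow> (real^'n \<Rightarrow> 'b::real_normed_vector) \<Rightarrow> real^'n \<Rightarrow> 'b" where
  "partial_deriv i f \<theta> = frechet_derivative f (at \<theta>) (axis i 1)"

primrec Ck :: "nat \<Rightarrow> (real^'n::finite \<Rightarrow> 'b::real_normed_vector) \<Rightarrow> bool" where
  "Ck 0 f \<longleftrightarrow> continuous_on UNIV f"
| "Ck (Suc k) f \<longleftrightarrow> f differentiable_on UNIV \<and> (\<forall>i. Ck k (partial_deriv i f))"

definition smooth :: "(real^'n::finite \<Rightarrow> 'b::real_normed_vector) \<Rightarrow> bool" where
  "smooth f \<longleftrightarrow> (\<forall>k. Ck k f)"


section \<open>Geometry of a parametrised family of functions on \<open>\<Omega>\<close>\<close>

text \<open>
  A family is an injective map \<open>P\<close> sending a parameter \<open>\<theta> \<in> \<real>\<^sup>n\<close> to a function on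
  \<open>\<Omega>\<close>.  The manifold is \<open>range P\<close>, and \<open>inv P\<close> is its global chart.  Tangent
  vectors and vector fields are written in this chart, so a vector field is a map
  \<open>X :: real^'n \<Rightarrow> real^'n\<close> standing for \<open>\<Sum>i. X\<^sub>i \<partial>\<^sub>i\<close>.
\<close>

definition coord_rep ::
  "(real^'n::finite \<Rightarrow> 'a \<Rightarrow> real) \<Rightarrow> (('a \<Rightarrow> real) \<Rightarrow> ('a \<Rightarrow> real)) \<Rightarrow> real^'n \<Rightarrow> real^'n" where
  "coord_rep P \<phi> = inv P \<circ> \<phi> \<circ> P"

text \<open>
  Maps of the manifold are taken extensional, so that two of them are equal as HOL
  functions precisely when they agree on \<open>range P\<close>.
\<close>

definition diffeo ::
  "(real^'n::finite \<Rightarrow> 'a \<Rightarrow> real) \<Rightarrow> (('a \<Rightarrow> real) \<Rightarrow> ('a \<Rightarrow> real)) \<Rightarrow> bool" where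
  "diffeo P \<phi> \<longleftrightarrow>
     \<phi> \<in> extensional (range P) \<and> bij_betw \<phi> (range P) (range P) \<and>
     smooth (coord_rep P \<phi>) \<and> smooth (coord_rep P (inv_into (range P) \<phi>))"

definition pushforward ::
  "(real^'n::finite \<Rightarrow> 'a \<Rightarrow> real) \<Rightarrow> (('a \<Rightarrow> real) \<Rightarrow> ('a \<Rightarrow> real)) \<Rightarrow>
   (real^'n \<Rightarrow> real^'n) \<Rightarrow> real^'n \<Rightarrow> real^'n" where
  "pushforward P \<phi> X \<eta> =
     (let \<theta> = coord_rep P (inv_into (range P) \<phi>) \<eta>
      in frechet_derivative (coord_rep P \<phi>) (at \<theta>) (X \<theta>))"

definition fisher_coeff ::
  "'a set \<Rightarrow> (real^'n::finite \<Rightarrow> 'a \<Rightarrow> real) \<Rightarrow> real^'n \<Rightarrow> 'n \<Rightarrow> 'n \<Rightarrow> real" where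
  "fisher_coeff \<Omega> P \<theta> i j =
     (\<Sum>y\<in>\<Omega>. P \<theta> y * partial_deriv i (\<lambda>\<eta>. ln (P \<eta> y)) \<theta>
                      * partial_deriv j (\<lambda>\<eta>. ln (P \<eta> y)) \<theta>)"

definition fisher_metric ::
  "'a set \<Rightarrow> (real^'n::finite \<Rightarrow> 'a \<Rightarrow> real) \<Rightarrow> real^'n \<Rightarrow> real^'n \<Rightarrow> real^'n \<Rightarrow> real" where
  "fisher_metric \<Omega> P \<theta> u v = (\<Sum>i\<in>UNIV. \<Sum>j\<in>UNIV. fisher_coeff \<Omega> P \<theta> i j * u $ i * v $ j)"

text \<open>
  The vector \<open>\<nabla>\<^sup>(\<^sup>e\<^sup>)\<close> of \<open>\<partial>\<^sub>j\<close> in direction \<open>\<partial>\<^sub>i\<close> at \<open>\<theta>\<close>, determined by its Fisher pairings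
  with the coordinate fields \<open>\<partial>\<^sub>k\<close>; it is unique because the Fisher metric is nondegenerate.
\<close>

definition e_nabla_basis ::
  "'a set \<Rightarrow> (real^'n::finite \<Rightarrow> 'a \<Rightarrow> real) \<Rightarrow> 'n \<Rightarrow> 'n \<Rightarrow> real^'n \<Rightarrow> real^'n" where
  "e_nabla_basis \<Omega> P i j \<theta> =
     (THE w. \<forall>k. fisher_metric \<Omega> P \<theta> w (axis k 1) =
        (\<Sum>y\<in>\<Omega>. P \<theta> y * partial_deriv i (partial_deriv j (\<lambda>\<eta>. ln (P \<eta> y))) \<theta>
                         * partial_deriv k (\<lambda>\<eta>. ln (P \<eta> y)) \<theta>))"

text \<open>Extension to arbitrary vector fields by linearity in \<open>X\<close> and the Leibniz rule in \<open>Y\<close>.\<close>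

definition e_connection ::
  "'a set \<Rightarrow> (real^'n::finite \<Rightarrow> 'a \<Rightarrow> real) \<Rightarrow>
   (real^'n \<Rightarrow> real^'n) \<Rightarrow> (real^'n \<Rightarrow> real^'n) \<Rightarrow> real^'n \<Rightarrow> real^'n" where
  "e_connection \<Omega> P X Y \<theta> =
     (\<Sum>i\<in>UNIV. X \<theta> $ i *\<^sub>R
        (partial_deriv i Y \<theta> + (\<Sum>j\<in>UNIV. Y \<theta> $ j *\<^sub>R e_nabla_basis \<Omega> P i j \<theta>)))"

definition isometric ::
  "'a set \<Rightarrow> (real^'n::finite \<Rightarrow> 'a \<Rightarrow> real) \<Rightarrow> (('a \<Rightarrow> real) \<Rightarrow> ('a \<Rightarrow> real)) \<Rightarrow> bool" where
  "isometric \<Omega> P \<phi> \<longleftrightarrow>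
     (\<forall>\<theta> u v. fisher_metric \<Omega> P (coord_rep P \<phi> \<theta>)
                (frechet_derivative (coord_rep P \<phi>) (at \<theta>) u)
                (frechet_derivative (coord_rep P \<phi>) (at \<theta>) v)
              = fisher_metric \<Omega> P \<theta> u v)"

definition e_affine ::
  "'a set \<Rightarrow> (real^'n::finite \<Rightarrow> 'a \<Rightarrow> real) \<Rightarrow> (('a \<Rightarrow> real) \<Rightarrow> ('a \<Rightarrow> real)) \<Rightarrow> bool" where
  "e_affine \<Omega> P \<phi> \<longleftrightarrow>
     (\<forall>X Y. smooth X \<longrightarrow> smooth Y \<longrightarrow>
        pushforward P \<phi> (e_connection \<Omega> P X Y) =
        e_connection \<Omega> P (pushforward P \<phi> X) (pushforward P \<phi> Y))"

text \<open>
  Underlying sets of the two groups; in both, multiplication is composition of maps of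
  \<open>range P\<close>.
\<close>

definition Diff ::
  "'a set \<Rightarrow> (real^'n::finite \<Rightarrow> 'a \<Rightarrow> real) \<Rightarrow> (('a \<Rightarrow> real) \<Rightarrow> ('a \<Rightarrow> real)) set" where
  "Diff \<Omega> P = {\<phi>. diffeo P \<phi> \<and> isometric \<Omega> P \<phi> \<and> e_affine \<Omega> P \<phi>}"

definition Perm ::
  "nat \<Rightarrow> (nat \<Rightarrow> 'a) \<Rightarrow> (real^'n::finite \<Rightarrow> 'a \<Rightarrow> real) \<Rightarrow> (('a \<Rightarrow> real) \<Rightarrow> ('a \<Rightarrow> real)) set" where
  "Perm m x P =
     {\<phi>. diffeo P \<phi> \<and>
         (\<exists>\<sigma>. \<sigma> permutes {1..m} \<and> (\<forall>p\<in>range P. \<forall>i\<in>{1..m}. \<phi> p (x i) = p (x (\<sigma> i))))}"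


section \<open>Exponential families\<close>

text \<open>Restriction to \<open>\<Omega>\<close> makes the elements genuine functions on \<open>\<Omega>\<close>.\<close>

definition exp_family ::
  "'a set \<Rightarrow> ('a \<Rightarrow> real) \<Rightarrow> ('a \<Rightarrow> real^'n::finite) \<Rightarrow> (real^'n \<Rightarrow> real) \<Rightarrow> real^'n \<Rightarrow> 'a \<Rightarrow> real" where
  "exp_family \<Omega> C F \<psi> \<theta> = (\<lambda>y\<in>\<Omega>. exp (C y + \<theta> \<bullet> F y - \<psi> \<theta>))"

definition lin_indep_with_one :: "'a set \<Rightarrow> ('a \<Rightarrow> real^'n::finite) \<Rightarrow> bool" where
  "lin_indep_with_one \<Omega> F \<longleftrightarrow>
     (\<forall>a b. (\<forall>y\<in>\<Omega>. a * 1 + (\<Sum>i\<in>UNIV. b i * F y $ i) = 0) \<longrightarrow> a = 0 \<and> (\<forall>i. b i = 0))"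

end

theory Submission
  imports Defs
begin

text \<open>
  In the chart \<open>\<theta>\<close> the connection is the flat one, so an affine \<open>\<phi>\<close> reads \<open>f \<theta> = A \<theta> + b\<close>.  The Fisher
  metric is the Hessian of \<open>\<psi>\<close>, so if \<open>\<phi>\<close> is moreover an isometry then
  \<open>\<psi> (A \<theta> + b) = \<psi> \<theta> + \<theta> \<bullet> c + d\<close>.  Exponentiating gives an identity between two sums over \<open>\<Omega>\<close> of
  exponentials with frequencies \<open>A\<^sup>T F(y)\<close> and \<open>F(y) + c\<close>.  Both families of frequencies are injective,
  so linear independence of exponentials matches them by a permutation of \<open>\<Omega>\<close>.  Conversely,
  a permutation carries scores to scores; hence it is an isometry, and since \<open>1, F\<^sup>1, \<dots>, F\<^sup>n\<close> are
  independent, the scores determine the derivative of \<open>f\<close>, which is therefore constant.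
\<close>

section \<open>Linear maps and functions with constant derivative\<close>

lemma linear_axis_expansion:
  fixes L :: "real^'n::finite \<Rightarrow> 'b::real_normed_vector"
  assumes "linear L"
  shows "L u = (\<Sum>i\<in>UNIV. u $ i *\<^sub>R L (axis i 1))"
proof -
  interpret L: linear L by fact
  have "L u = L (\<Sum>i\<in>UNIV. u $ i *\<^sub>R axis i 1)"
    using basis_expansion[of u] by (simp add: scalar_mult_eq_scaleR)
  then show ?thesis by (simp add: L.sum L.scaleR)
qed

lemma partial_deriv_eq:
  assumes "(f has_derivative f') (at \<theta>)"
  shows "partial_deriv i f \<theta> = f' (axis i 1)"
  using frechet_derivative_at[OF assms] by (simp add: partial_deriv_def)

lemma constant_derivative_affine:
  fixes f :: "'b::real_normed_vector \<Rightarrow> 'c::real_normed_vector"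
  assumes "\<And>\<theta>. (f has_derivative A) (at \<theta>)"
  obtains b where "\<And>\<theta>. f \<theta> = A \<theta> + b"
proof -
  have bl: "bounded_linear A" using assms has_derivative_bounded_linear by blast
  have "\<exists>c. \<forall>\<theta>\<in>UNIV. f \<theta> - A \<theta> = c"
  proof (rule has_derivative_zero_constant)
    show "((\<lambda>\<theta>. f \<theta> - A \<theta>) has_derivative (\<lambda>h. 0)) (at \<theta> within UNIV)" for \<theta>
      using has_derivative_diff[OF assms bounded_linear_imp_has_derivative[OF bl]]
      by simp
  qed simp
  then obtain b where "\<And>\<theta>. f \<theta> - A \<theta> = b" by auto
  then show thesis by (intro that[of b]) (metis add.commute diff_add_cancel)
qed

section \<open>Linear independence of exponentials\<close>

text \<open>Among the frequencies with nonzero coefficient let \<open>w\<close> have maximal norm.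
  Along the ray through \<open>w\<close>, after division by
  \<open>exp (t * (w \<bullet> w))\<close>, every other term decays, so the vanishing sum would tend
  to \<open>a w\<close>, which is nonzero.\<close>

lemma exp_sum_eq_zero:
  fixes S :: "'v::real_inner set" and a :: "'v \<Rightarrow> real"
  assumes fin: "finite S" and zero: "\<And>\<theta>. (\<Sum>s\<in>S. a s * exp (\<theta> \<bullet> s)) = 0" and "s \<in> S"
  shows "a s = 0"
proof (rule ccontr)
  assume "a s \<noteq> 0"
  define T where "T = {s \<in> S. a s \<noteq> 0}"
  have "finite T" "T \<noteq> {}" using fin \<open>s \<in> S\<close> \<open>a s \<noteq> 0\<close> by (auto simp: T_def)
  then have "Max (norm ` T) \<in> norm ` T" by simp
  then obtain w where w: "w \<in> T" and "norm w = Max (norm ` T)" by (metis imageE)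
  with \<open>finite T\<close> have wmax: "norm t \<le> norm w" if "t \<in> T" for t using that by simp
  \<comment> \<open>A frequency of maximal norm dominates all others along its own direction.\<close>
  have less: "w \<bullet> t < w \<bullet> w" if "t \<in> T" "t \<noteq> w" for t
  proof -
    have "0 < (w - t) \<bullet> (w - t)" using that by simp
    also have "\<dots> = w \<bullet> w - 2 * (w \<bullet> t) + t \<bullet> t"
      by (simp add: inner_diff_left inner_diff_right inner_commute)
    also have "t \<bullet> t \<le> w \<bullet> w"
      using wmax[OF that(1)] by (simp add: norm_le)
    finally show ?thesis by simp
  qed
  define h where "h t = (\<Sum>s\<in>T. a s * exp (t * (w \<bullet> s - w \<bullet> w)))" for t :: real
  have "h t = 0" for t
  proof -
    have "0 = (\<Sum>s\<in>S. a s * exp ((t *\<^sub>R w) \<bullet> s))" by (rule zero[symmetric])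
    also have "\<dots> = (\<Sum>s\<in>T. a s * exp ((t *\<^sub>R w) \<bullet> s))"
      by (rule sum.mono_neutral_right) (auto simp: T_def fin)
    also have "\<dots> = (\<Sum>s\<in>T. a s * exp (t * (w \<bullet> s - w \<bullet> w))) * exp (t * (w \<bullet> w))"
      by (simp add: sum_distrib_right right_diff_distrib mult.assoc flip: exp_add)
    finally show ?thesis by (simp add: h_def)
  qed
  moreover have "(h \<longlongrightarrow> (\<Sum>s\<in>T. if s = w then a w else 0)) at_top"
    unfolding h_def
  proof (rule tendsto_sum)
    fix t assume t: "t \<in> T"
    show "((\<lambda>r. a t * exp (r * (w \<bullet> t - w \<bullet> w))) \<longlongrightarrow> (if t = w then a w else 0)) at_top"
    proof (cases "t = w")
      case False
      with less t have "w \<bullet> t - w \<bullet> w < 0" by simp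
      then have "filterlim (\<lambda>r. r * (w \<bullet> t - w \<bullet> w)) at_bot at_top"
        by (intro filterlim_tendsto_neg_mult_at_bot[OF tendsto_const _ filterlim_ident,
              simplified mult.commute])
      then have "((\<lambda>r. exp (r * (w \<bullet> t - w \<bullet> w))) \<longlongrightarrow> 0) at_top"
        by (rule filterlim_compose[OF exp_at_bot])
      from tendsto_mult_right_zero[OF this] False show ?thesis by simp
    qed simp
  qed
  ultimately have "(\<Sum>s\<in>T. if s = w then a w else 0) = 0"
    using tendsto_unique[OF trivial_limit_at_top_linorder]
    by (metis (no_types, lifting) ext tendsto_const)
  with \<open>finite T\<close> w show False by (simp add: T_def)
qed

text \<open>Injectivity gives each frequency a single coefficient on each side, so independence
  compares them one by one. Positivity keeps frequencies from dropping out; hence the images of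
  \<open>f\<close> and \<open>g\<close> agree and \<open>\<tau>\<close> is \<open>f\<close> followed
  by the inverse of \<open>g\<close>.\<close>

lemma exp_sums_eq_imp_bij:
  fixes f g :: "'b \<Rightarrow> 'v::real_inner" and \<alpha> \<beta> :: "'b \<Rightarrow> real"
  assumes fin: "finite B" and f: "inj_on f B" and g: "inj_on g B"
    and pos: "\<And>y. y \<in> B \<Longrightarrow> 0 < \<alpha> y" "\<And>y. y \<in> B \<Longrightarrow> 0 < \<beta> y"
    and eq: "\<And>\<theta>. (\<Sum>y\<in>B. \<alpha> y * exp (\<theta> \<bullet> f y)) = (\<Sum>y\<in>B. \<beta> y * exp (\<theta> \<bullet> g y))"
  obtains \<tau> where "bij_betw \<tau> B B" "\<And>y. y \<in> B \<Longrightarrow> g (\<tau> y) = f y" "\<And>y. y \<in> B \<Longrightarrow> \<beta> (\<tau> y) = \<alpha> y"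
proof -
  define S where "S = f ` B \<union> g ` B"
  \<comment> \<open>The default 0 off the image of \<open>f\<close> (and of \<open>g\<close> for
    \<open>b\<close>) lets both sums run over the common frequency set \<open>S\<close>.\<close>
  define a where "a s = (if s \<in> f ` B then \<alpha> (inv_into B f s) else 0)" for s
  define b where "b s = (if s \<in> g ` B then \<beta> (inv_into B g s) else 0)" for s
  have finS: "finite S" using fin by (simp add: S_def)
  have sa: "(\<Sum>s\<in>S. a s * exp (\<theta> \<bullet> s)) = (\<Sum>y\<in>B. \<alpha> y * exp (\<theta> \<bullet> f y))" for \<theta>
  proof -
    have "(\<Sum>s\<in>S. a s * exp (\<theta> \<bullet> s)) = (\<Sum>s\<in>f ` B. a s * exp (\<theta> \<bullet> s))"
      by (rule sum.mono_neutral_right) (auto simp: S_def a_def fin)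
    then show ?thesis by (simp add: sum.reindex[OF f] a_def f)
  qed
  have sb: "(\<Sum>s\<in>S. b s * exp (\<theta> \<bullet> s)) = (\<Sum>y\<in>B. \<beta> y * exp (\<theta> \<bullet> g y))" for \<theta>
  proof -
    have "(\<Sum>s\<in>S. b s * exp (\<theta> \<bullet> s)) = (\<Sum>s\<in>g ` B. b s * exp (\<theta> \<bullet> s))"
      by (rule sum.mono_neutral_right) (auto simp: S_def b_def fin)
    then show ?thesis by (simp add: sum.reindex[OF g] b_def g)
  qed
  have ab: "a s = b s" if "s \<in> S" for s
  proof -
    have "(\<Sum>s\<in>S. (a s - b s) * exp (\<theta> \<bullet> s)) = 0" for \<theta>
      using sa[of \<theta>] sb[of \<theta>] eq[of \<theta>] by (simp add: left_diff_distrib sum_subtractf)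
    from exp_sum_eq_zero[OF finS this that] show ?thesis by simp
  qed
  \<comment> \<open>If \<open>g\<close> missed the frequency \<open>f y\<close>, then
    \<open>b (f y)\<close> would be 0 while \<open>a (f y) = \<alpha> y\<close> is positive.\<close>
  have "f y \<in> g ` B" if "y \<in> B" for y
    using ab[of "f y"] pos(1)[OF that] that f by (auto simp: S_def a_def b_def split: if_splits)
  moreover have "g y \<in> f ` B" if "y \<in> B" for y
    using ab[of "g y"] pos(2)[OF that] that g by (auto simp: S_def a_def b_def split: if_splits)
  ultimately have img: "f ` B = g ` B" by auto
  define \<tau> where "\<tau> y = inv_into B g (f y)" for y
  have "bij_betw \<tau> B B"
    using bij_betw_trans[OF inj_on_imp_bij_betw[OF f, unfolded img]
        bij_betw_inv_into[OF inj_on_imp_bij_betw[OF g]]]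
    by (simp add: \<tau>_def[abs_def] comp_def)
  moreover have "g (\<tau> y) = f y" if "y \<in> B" for y
    using that img by (auto simp: \<tau>_def intro!: f_inv_into_f)
  moreover have "\<beta> (\<tau> y) = \<alpha> y" if "y \<in> B" for y
    using ab[of "f y"] that f by (auto simp: S_def a_def b_def \<tau>_def simp flip: img)
  ultimately show thesis by (rule that)
qed

section \<open>Diffeomorphisms in coordinates\<close>

lemma smooth_differentiable:
  assumes "smooth f"
  shows "f differentiable (at \<theta>)"
proof -
  have "Ck (Suc 0) f" using assms unfolding smooth_def by blast
  then show ?thesis by (simp add: differentiable_on_def)
qed

lemma smooth_partial_deriv: "smooth f \<Longrightarrow> smooth (partial_deriv i f)"
  unfolding smooth_def using Ck.simps(2) by blast

lemma Ck_const: "Ck k (\<lambda>_. c)"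
proof (induction k arbitrary: c)
  case (Suc k)
  have "partial_deriv i (\<lambda>_. c) = (\<lambda>_. 0)" for i :: 'a
    using partial_deriv_eq[OF has_derivative_const] by blast
  with Suc show ?case by simp
qed simp

lemma smooth_const: "smooth (\<lambda>_. c)"
  by (simp add: smooth_def Ck_const)

lemma coord_rep_diffeo:
  assumes inj: "inj P" and \<phi>: "diffeo P \<phi>"
  shows "P (coord_rep P \<phi> \<theta>) = \<phi> (P \<theta>)"
    and "coord_rep P (inv_into (range P) \<phi>) (coord_rep P \<phi> \<theta>) = \<theta>"
    and "coord_rep P \<phi> (coord_rep P (inv_into (range P) \<phi>) \<theta>) = \<theta>"
proof -
  have bij: "bij_betw \<phi> (range P) (range P)" using \<phi> by (simp add: diffeo_def)
  have bij': "bij_betw (inv_into (range P) \<phi>) (range P) (range P)"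
    by (rule bij_betw_inv_into[OF bij])
  have *: "P (inv P q) = q" if "q \<in> range P" for q using that by (rule f_inv_into_f)
  have m: "\<phi> (P \<theta>) \<in> range P" for \<theta> using bij by (auto simp: bij_betw_def)
  have m': "inv_into (range P) \<phi> (P \<theta>) \<in> range P" for \<theta>
    using bij_betw_apply[OF bij'] by simp
  show "P (coord_rep P \<phi> \<theta>) = \<phi> (P \<theta>)"
    unfolding coord_rep_def o_def by (rule *[OF m])
  show "coord_rep P (inv_into (range P) \<phi>) (coord_rep P \<phi> \<theta>) = \<theta>"
    unfolding coord_rep_def o_def *[OF m] using bij_betw_inv_into_left[OF bij] inj by simp
  show "coord_rep P \<phi> (coord_rep P (inv_into (range P) \<phi>) \<theta>) = \<theta>"
    unfolding coord_rep_def o_def *[OF m'] using bij_betw_inv_into_right[OF bij] inj by simp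
qed

section \<open>Exponential families\<close>

text \<open>Normalisation forces \<open>\<psi>\<close> to be the logarithm of the partition
  function, as \<open>exp_psi\<close> shows. The enumeration of \<open>\<Omega>\<close> enters only
  in the final theorem.\<close>

locale exponential_family =
  fixes \<Omega> :: "'a set" and C :: "'a \<Rightarrow> real" and F :: "'a \<Rightarrow> real^'n::finite"
    and \<psi> :: "real^'n \<Rightarrow> real"
  assumes fin: "finite \<Omega>"
    and normalised: "(\<Sum>y\<in>\<Omega>. exp_family \<Omega> C F \<psi> \<theta> y) = 1"
    and indep: "lin_indep_with_one \<Omega> F"
begin

abbreviation P :: "real^'n \<Rightarrow> 'a \<Rightarrow> real" where
  "P \<equiv> exp_family \<Omega> C F \<psi>"

text \<open>The expectation of \<open>F\<close> under \<open>P \<theta>\<close>, which is the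
  gradient of \<open>\<psi>\<close>.\<close>

definition mean :: "real^'n \<Rightarrow> real^'n" where
  "mean \<theta> = (\<Sum>y\<in>\<Omega>. P \<theta> y *\<^sub>R F y)"

lemma P_eq: "y \<in> \<Omega> \<Longrightarrow> P \<theta> y = exp (C y + \<theta> \<bullet> F y - \<psi> \<theta>)"
  by (simp add: exp_family_def)

lemma P_pos: "y \<in> \<Omega> \<Longrightarrow> 0 < P \<theta> y"
  by (simp add: P_eq)

lemma ln_P: "y \<in> \<Omega> \<Longrightarrow> ln (P \<theta> y) = C y + \<theta> \<bullet> F y - \<psi> \<theta>"
  by (simp add: P_eq)

text \<open>The form in which linear independence is used: \<open>w \<bullet> F y - c = 0\<close> on
  \<open>\<Omega>\<close> is a linear relation between 1 and the components of
  \<open>F\<close>.\<close>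

lemma inner_F_const_imp_zero:
  assumes "\<And>y. y \<in> \<Omega> \<Longrightarrow> w \<bullet> F y = c"
  shows "w = 0"
proof -
  have "\<forall>y\<in>\<Omega>. (- c) * 1 + (\<Sum>i\<in>UNIV. w $ i * F y $ i) = 0"
    using assms by (auto simp: inner_vec_def)
  with indep have "\<forall>i. w $ i = 0" unfolding lin_indep_with_one_def by blast
  then show ?thesis by (simp add: vec_eq_iff)
qed

lemma inj_P: "inj P"
proof (rule injI)
  fix \<theta> \<eta> assume eq: "P \<theta> = P \<eta>"
  have "(\<theta> - \<eta>) \<bullet> F y = \<psi> \<theta> - \<psi> \<eta>" if "y \<in> \<Omega>" for y
    using ln_P[OF that, of \<theta>] ln_P[OF that, of \<eta>] eq by (simp add: inner_diff_left)
  from inner_F_const_imp_zero[OF this] show "\<theta> = \<eta>" by simp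
qed

lemma exp_psi: "exp (\<psi> \<theta>) = (\<Sum>y\<in>\<Omega>. exp (C y + \<theta> \<bullet> F y))"
proof -
  have "1 = (\<Sum>y\<in>\<Omega>. exp (C y + \<theta> \<bullet> F y)) / exp (\<psi> \<theta>)"
    using normalised[of \<theta>] by (simp add: P_eq exp_diff sum_divide_distrib)
  then show ?thesis by (simp add: field_simps)
qed

lemma psi_has_derivative: "(\<psi> has_derivative (\<lambda>u. u \<bullet> mean \<theta>)) (at \<theta>)"
proof -
  let ?Z = "\<lambda>\<theta>. \<Sum>y\<in>\<Omega>. exp (C y + \<theta> \<bullet> F y)"
  have Z: "?Z \<theta> = exp (\<psi> \<theta>)" for \<theta> by (simp add: exp_psi)
  have \<psi>: "\<psi> = (\<lambda>\<theta>. ln (?Z \<theta>))" by (simp add: Z)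
  have "((\<lambda>\<theta>. ln (?Z \<theta>)) has_derivative
      (\<lambda>u. (\<Sum>y\<in>\<Omega>. exp (C y + \<theta> \<bullet> F y) * (u \<bullet> F y)) / ?Z \<theta>)) (at \<theta>)"
    by (rule derivative_eq_intros refl | simp add: Z divide_inverse mult.commute)+
  moreover have "(\<Sum>y\<in>\<Omega>. exp (C y + \<theta> \<bullet> F y) * (u \<bullet> F y)) / ?Z \<theta> = u \<bullet> mean \<theta>" for u
    unfolding Z by (simp add: mean_def inner_sum_right P_eq exp_diff sum_divide_distrib)
  ultimately show ?thesis by (simp add: \<psi>[symmetric])
qed

lemma ln_P_has_derivative:
  assumes "y \<in> \<Omega>"
  shows "((\<lambda>\<theta>. ln (P \<theta> y)) has_derivative (\<lambda>u. u \<bullet> (F y - mean \<theta>))) (at \<theta>)"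
  unfolding ln_P[OF assms]
  by (rule derivative_eq_intros psi_has_derivative refl | simp add: inner_diff_right)+

lemma P_has_derivative:
  assumes "y \<in> \<Omega>"
  shows "((\<lambda>\<theta>. P \<theta> y) has_derivative (\<lambda>u. P \<theta> y * (u \<bullet> (F y - mean \<theta>)))) (at \<theta>)"
  unfolding P_eq[OF assms]
  by (rule derivative_eq_intros psi_has_derivative refl | simp add: inner_diff_right algebra_simps)+

section \<open>Fisher metric and exponential connection in the chart\<close>

lemma sum_P_centred: "(\<Sum>y\<in>\<Omega>. P \<theta> y * (u \<bullet> (F y - mean \<theta>))) = 0"
proof -
  have "(\<Sum>y\<in>\<Omega>. P \<theta> y * (u \<bullet> (F y - mean \<theta>)))
      = u \<bullet> mean \<theta> - (\<Sum>y\<in>\<Omega>. P \<theta> y) * (u \<bullet> mean \<theta>)"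
    by (simp add: mean_def inner_sum_right inner_diff_right right_diff_distrib sum_subtractf
        sum_distrib_right)
  then show ?thesis by (simp add: normalised)
qed

text \<open>The right-hand side is the covariance form of \<open>F\<close> under
  \<open>P \<theta>\<close>; \<open>F y - mean \<theta>\<close> is the score vector at
  \<open>y\<close>.\<close>

lemma fisher_metric_eq:
  "fisher_metric \<Omega> P \<theta> u v = (\<Sum>y\<in>\<Omega>. P \<theta> y * (u \<bullet> (F y - mean \<theta>)) * (v \<bullet> (F y - mean \<theta>)))"
proof -
  have c: "fisher_coeff \<Omega> P \<theta> i j = (\<Sum>y\<in>\<Omega>. P \<theta> y * (F y - mean \<theta>) $ i * (F y - mean \<theta>) $ j)"
    for i j
    unfolding fisher_coeff_def
    by (rule sum.cong) (simp_all add: partial_deriv_eq[OF ln_P_has_derivative] inner_axis')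
  have "fisher_metric \<Omega> P \<theta> u v = (\<Sum>i\<in>UNIV. \<Sum>j\<in>UNIV. \<Sum>y\<in>\<Omega>.
      P \<theta> y * (u $ i * (F y - mean \<theta>) $ i) * (v $ j * (F y - mean \<theta>) $ j))"
    unfolding fisher_metric_def c by (simp add: sum_distrib_left sum_distrib_right algebra_simps)
  also have "\<dots> = (\<Sum>y\<in>\<Omega>. \<Sum>i\<in>UNIV. \<Sum>j\<in>UNIV.
      P \<theta> y * (u $ i * (F y - mean \<theta>) $ i) * (v $ j * (F y - mean \<theta>) $ j))"
    \<comment> \<open>The sum over \<open>y\<close> moves outwards, first past \<open>j\<close> and
      then past \<open>i\<close>.\<close>
    by (subst (2) sum.swap, subst sum.swap, rule refl)
  also have "\<dots> = (\<Sum>y\<in>\<Omega>. P \<theta> y * (u \<bullet> (F y - mean \<theta>)) * (v \<bullet> (F y - mean \<theta>)))"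
    by (simp only: inner_vec_def inner_real_def mult.assoc sum_product)
      (simp only: sum_distrib_left mult.assoc)
  finally show ?thesis .
qed

text \<open>As \<open>mean\<close> is the gradient of \<open>\<psi>\<close>, this identifies the
  Fisher metric with the Hessian of \<open>\<psi>\<close>.\<close>

lemma mean_inner_has_derivative:
  "((\<lambda>\<theta>. v \<bullet> mean \<theta>) has_derivative (\<lambda>u. fisher_metric \<Omega> P \<theta> u v)) (at \<theta>)"
proof -
  have "((\<lambda>\<theta>. \<Sum>y\<in>\<Omega>. P \<theta> y * (v \<bullet> F y)) has_derivative
      (\<lambda>u. \<Sum>y\<in>\<Omega>. P \<theta> y * (u \<bullet> (F y - mean \<theta>)) * (v \<bullet> F y))) (at \<theta>)"
    by (rule has_derivative_sum has_derivative_mult_left P_has_derivative)+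
  moreover have "(\<Sum>y\<in>\<Omega>. P \<theta> y * (u \<bullet> (F y - mean \<theta>)) * (v \<bullet> F y)) = fisher_metric \<Omega> P \<theta> u v"
    for u
  proof -
    \<comment> \<open>Centring the second factor changes nothing, because the score has expectation
      zero.\<close>
    have "fisher_metric \<Omega> P \<theta> u v = (\<Sum>y\<in>\<Omega>. P \<theta> y * (u \<bullet> (F y - mean \<theta>)) * (v \<bullet> F y))
        - (\<Sum>y\<in>\<Omega>. P \<theta> y * (u \<bullet> (F y - mean \<theta>))) * (v \<bullet> mean \<theta>)"
      unfolding fisher_metric_eq inner_diff_right[of v]
      by (simp add: right_diff_distrib[of "_ * _"] sum_subtractf sum_distrib_right)
    then show ?thesis by (simp add: sum_P_centred)
  qed
  ultimately show ?thesis by (simp add: mean_def inner_sum_right)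
qed

text \<open>A sum of squares with positive weights vanishes only termwise, which makes
  \<open>w \<bullet> F y\<close> constant on \<open>\<Omega>\<close>.\<close>

lemma fisher_metric_self_zero:
  assumes "fisher_metric \<Omega> P \<theta> w w = 0"
  shows "w = 0"
proof -
  have nonneg: "0 \<le> P \<theta> y * (w \<bullet> (F y - mean \<theta>)) * (w \<bullet> (F y - mean \<theta>))" if "y \<in> \<Omega>" for y
    using P_pos[OF that, of \<theta>] by (simp add: mult.assoc)
  have "w \<bullet> F y = w \<bullet> mean \<theta>" if "y \<in> \<Omega>" for y
    using assms sum_nonneg_eq_0_iff[OF fin nonneg] that P_pos[OF that, of \<theta>]
    by (auto simp: fisher_metric_eq inner_diff_right)
  then show ?thesis by (rule inner_F_const_imp_zero)
qed

text \<open>The canonical parameters are affine coordinates: all defining pairings vanish, and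
  nondegeneracy makes 0 the only vector with these pairings, which evaluates the
  \<open>THE\<close>.\<close>

lemma e_nabla_basis_zero: "e_nabla_basis \<Omega> P i j \<theta> = 0"
proof -
  have pj: "partial_deriv j (\<lambda>\<eta>. ln (P \<eta> y)) = (\<lambda>\<theta>. F y $ j - axis j 1 \<bullet> mean \<theta>)"
    if "y \<in> \<Omega>" for y j
    by (rule ext) (simp add: partial_deriv_eq[OF ln_P_has_derivative[OF that]] inner_axis')
  have pij: "partial_deriv i (partial_deriv j (\<lambda>\<eta>. ln (P \<eta> y))) \<theta>
      = - fisher_metric \<Omega> P \<theta> (axis i 1) (axis j 1)" if "y \<in> \<Omega>" for y
    using partial_deriv_eq[OF has_derivative_diff[OF has_derivative_const
        mean_inner_has_derivative[of "axis j 1"]], of i "F y $ j" \<theta>]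
    by (simp add: pj[OF that])
  \<comment> \<open>The second derivatives of \<open>ln p\<close> do not depend on the point of \<open>\<Omega>\<close>,
    and the score has expectation zero.\<close>
  have rhs: "(\<Sum>y\<in>\<Omega>. P \<theta> y * partial_deriv i (partial_deriv j (\<lambda>\<eta>. ln (P \<eta> y))) \<theta>
      * partial_deriv k (\<lambda>\<eta>. ln (P \<eta> y)) \<theta>) = 0" for k
  proof -
    have "(\<Sum>y\<in>\<Omega>. P \<theta> y * partial_deriv i (partial_deriv j (\<lambda>\<eta>. ln (P \<eta> y))) \<theta>
      * partial_deriv k (\<lambda>\<eta>. ln (P \<eta> y)) \<theta>) =
      (\<Sum>y\<in>\<Omega>. P \<theta> y * (axis k 1 \<bullet> (F y - mean \<theta>))) * - fisher_metric \<Omega> P \<theta> (axis i 1) (axis j 1)"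
      unfolding sum_distrib_right
      by (rule sum.cong)
        (simp_all add: pij partial_deriv_eq[OF ln_P_has_derivative])
    then show ?thesis by (simp add: sum_P_centred)
  qed
  \<comment> \<open>Uniqueness: zero pairings with the coordinate fields extend by linearity to the
    pairing of \<open>w\<close> with itself.\<close>
  have "w = 0" if "\<forall>k. fisher_metric \<Omega> P \<theta> w (axis k 1) = 0" for w
  proof (rule fisher_metric_self_zero)
    have "linear (\<lambda>v. fisher_metric \<Omega> P \<theta> w v)"
      by (rule linearI) (simp_all add: fisher_metric_eq inner_add_left distrib_left sum.distrib
          sum_distrib_left mult.left_commute)
    from linear_axis_expansion[OF this, of w] that show "fisher_metric \<Omega> P \<theta> w w = 0" by simp
  qed
  then show ?thesis unfolding e_nabla_basis_def rhs
    by (intro the_equality) (auto simp: fisher_metric_eq)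
qed

text \<open>With vanishing connection coefficients only the directional derivative remains.\<close>

lemma e_connection_eq:
  assumes "(Y has_derivative Y') (at \<theta>)"
  shows "e_connection \<Omega> P X Y \<theta> = Y' (X \<theta>)"
  using linear_axis_expansion[OF has_derivative_linear[OF assms], of "X \<theta>"]
  by (simp add: e_connection_def e_nabla_basis_zero partial_deriv_eq[OF assms])

end

section \<open>Diffeomorphisms of the family in canonical coordinates\<close>

locale exponential_family_diffeo = exponential_family \<Omega> C F \<psi>
  for \<Omega> :: "'a set" and C :: "'a \<Rightarrow> real" and F :: "'a \<Rightarrow> real^'n::finite"
    and \<psi> :: "real^'n \<Rightarrow> real" +
  fixes \<phi> :: "('a \<Rightarrow> real) \<Rightarrow> 'a \<Rightarrow> real"
  assumes diffeo: "diffeo P \<phi>"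
begin

definition f where "f = coord_rep P \<phi>"
definition g where "g = coord_rep P (inv_into (range P) \<phi>)"

abbreviation Df where "Df \<theta> \<equiv> frechet_derivative f (at \<theta>)"

lemma P_f: "P (f \<theta>) = \<phi> (P \<theta>)" and g_f [simp]: "g (f \<theta>) = \<theta>" and f_g [simp]: "f (g \<theta>) = \<theta>"
  unfolding f_def g_def by (rule coord_rep_diffeo[OF inj_P diffeo])+

lemma smooth_f: "smooth f" and smooth_g: "smooth g"
  using diffeo by (simp_all add: diffeo_def f_def g_def)

lemma f_has_derivative: "(f has_derivative Df \<theta>) (at \<theta>)"
  using smooth_differentiable[OF smooth_f] frechet_derivative_works by blast

lemma pushforward_eq: "pushforward P \<phi> X = (\<lambda>\<eta>. Df (g \<eta>) (X (g \<eta>)))"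
  by (simp add: fun_eq_iff pushforward_def f_def g_def Let_def)

text \<open>Affinity is tested on constant fields. These are parallel, so their pushforwards are
  parallel too; pulled back along \<open>f\<close>, this says that every partial derivative of
  \<open>f\<close> has derivative zero.\<close>

lemma e_affine_imp_affine:
  assumes "e_affine \<Omega> P \<phi>"
  obtains A b where "linear A" "\<And>\<theta>. f \<theta> = A \<theta> + b" "\<And>\<theta>. Df \<theta> = A"
proof -
  have "\<exists>c. \<forall>\<theta>\<in>UNIV. partial_deriv i f \<theta> = c" for i
  proof (rule has_derivative_zero_constant)
    fix \<theta>
    define p where "p = partial_deriv i f"
    have "smooth p" unfolding p_def by (rule smooth_partial_deriv[OF smooth_f])
    have g: "(g has_derivative frechet_derivative g (at (f \<theta>))) (at (f \<theta>))"
      using smooth_differentiable[OF smooth_g] frechet_derivative_works by blast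
    have p: "(p has_derivative frechet_derivative p (at (g (f \<theta>)))) (at (g (f \<theta>)))"
      using smooth_differentiable[OF \<open>smooth p\<close>] frechet_derivative_works by blast
    \<comment> \<open>\<open>H\<close> differentiates \<open>p \<circ> g\<close>, the pushforward of
      the \<open>i\<close>-th coordinate field.\<close>
    define H where "H = frechet_derivative p (at (g (f \<theta>))) \<circ> frechet_derivative g (at (f \<theta>))"
    have h: "(p \<circ> g has_derivative H) (at (f \<theta>))"
      unfolding H_def by (rule diff_chain_at[OF g p])
    have "H (Df \<theta> u) = 0" for u
    proof -
      let ?U = "\<lambda>_. u" and ?E = "\<lambda>_. axis i 1 :: real^'n"
      have "pushforward P \<phi> (e_connection \<Omega> P ?U ?E)
          = e_connection \<Omega> P (pushforward P \<phi> ?U) (pushforward P \<phi> ?E)"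
        using assms smooth_const unfolding e_affine_def by blast
      moreover have "e_connection \<Omega> P ?U ?E = (\<lambda>_. 0)"
        by (rule ext) (simp add: e_connection_eq[OF has_derivative_const])
      moreover have "pushforward P \<phi> ?E = p \<circ> g"
        by (simp add: pushforward_eq p_def partial_deriv_def fun_eq_iff)
      ultimately have "pushforward P \<phi> (\<lambda>_. 0) (f \<theta>)
          = e_connection \<Omega> P (pushforward P \<phi> ?U) (p \<circ> g) (f \<theta>)" by simp
      then show ?thesis
        using linear_0[OF has_derivative_linear[OF f_has_derivative[of \<theta>]]]
        by (simp add: e_connection_eq[OF h] pushforward_eq)
    qed
    then have "H \<circ> Df \<theta> = (\<lambda>_. 0)" by (simp add: fun_eq_iff)
    moreover have "((p \<circ> g) \<circ> f has_derivative H \<circ> Df \<theta>) (at \<theta>)"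
      by (rule diff_chain_at[OF f_has_derivative h])
    moreover have "(p \<circ> g) \<circ> f = p" by (simp add: fun_eq_iff)
    ultimately show "(partial_deriv i f has_derivative (\<lambda>h. 0)) (at \<theta> within UNIV)"
      by (simp add: p_def)
  qed simp
  then have const: "partial_deriv i f \<theta> = partial_deriv i f 0" for i \<theta> by (metis UNIV_I)
  have D: "Df \<theta> = Df 0" for \<theta>
  proof
    fix u
    show "Df \<theta> u = Df 0 u"
      using linear_axis_expansion[OF has_derivative_linear[OF f_has_derivative], of \<theta> u]
        linear_axis_expansion[OF has_derivative_linear[OF f_has_derivative], of 0 u]
        const[of _ \<theta>]
      by (simp add: partial_deriv_def)
  qed
  have "(f has_derivative Df 0) (at \<theta>)" for \<theta>
    using f_has_derivative[of \<theta>] unfolding D[of \<theta>] .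
  then obtain b where "\<And>\<theta>. f \<theta> = Df 0 \<theta> + b" using constant_derivative_affine by blast
  then show thesis using that[of "Df 0" b] has_derivative_linear[OF f_has_derivative] D by blast
qed

text \<open>\<open>\<tau>\<close> matches the frequency \<open>adjoint A (F y)\<close> with
  \<open>F (\<tau> y) + c\<close>; equality of the matched coefficients then makes the
  log-probabilities agree.\<close>

lemma affine_isometry_imp_permutation:
  assumes affine: "e_affine \<Omega> P \<phi>" and iso: "isometric \<Omega> P \<phi>" and inj: "inj_on F \<Omega>"
  obtains \<tau> where "bij_betw \<tau> \<Omega> \<Omega>" "\<And>\<theta> y. y \<in> \<Omega> \<Longrightarrow> \<phi> (P \<theta>) y = P \<theta> (\<tau> y)"
proof -
  obtain A b where lin: "linear A" and f: "\<And>\<theta>. f \<theta> = A \<theta> + b" and A: "\<And>\<theta>. Df \<theta> = A"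
    using e_affine_imp_affine[OF affine] by blast
  have Df: "(f has_derivative A) (at \<theta>)" for \<theta> using f_has_derivative[of \<theta>] A by simp
  \<comment> \<open>Since the Fisher metric is the Hessian of \<open>\<psi>\<close>, the functions \<open>\<psi> \<circ> f\<close> and \<open>\<psi>\<close> have the same
    Hessian and so differ by an affine function.\<close>
  define k where "k \<theta> = \<psi> (f \<theta>) - \<psi> \<theta>" for \<theta>
  define k' where "k' \<theta> u = A u \<bullet> mean (f \<theta>) - u \<bullet> mean \<theta>" for \<theta> u
  have k: "(k has_derivative k' \<theta>) (at \<theta>)" for \<theta>
    unfolding k_def[abs_def] k'_def[abs_def]
    by (rule has_derivative_diff psi_has_derivative has_derivative_compose[OF Df psi_has_derivative])+
  \<comment> \<open>For fixed \<open>u\<close>, the derivative of \<open>k' \<theta> u\<close> in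
    \<open>\<theta>\<close> is the pulled-back Fisher metric minus the original one, which is 0 for
    an isometry.\<close>
  have "\<exists>c. \<forall>\<theta>\<in>UNIV. k' \<theta> u = c" for u
  proof (rule has_derivative_zero_constant)
    fix \<theta>
    have "((\<lambda>\<theta>. k' \<theta> u) has_derivative
        (\<lambda>v. fisher_metric \<Omega> P (f \<theta>) (A v) (A u) - fisher_metric \<Omega> P \<theta> v u)) (at \<theta>)"
      unfolding k'_def
      by (rule has_derivative_diff mean_inner_has_derivative
          has_derivative_compose[OF Df mean_inner_has_derivative])+
    moreover have "fisher_metric \<Omega> P (f \<theta>) (A v) (A u) = fisher_metric \<Omega> P \<theta> v u" for v
      using iso A unfolding isometric_def f_def by simp
    ultimately show "((\<lambda>\<theta>. k' \<theta> u) has_derivative (\<lambda>h. 0)) (at \<theta> within UNIV)" by simp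
  qed simp
  then have "k' \<theta> u = k' 0 u" for \<theta> u by (metis UNIV_I)
  then have "k' \<theta> = k' 0" for \<theta> by blast
  with k have k0: "(k has_derivative k' 0) (at \<theta>)" for \<theta> by metis
  then obtain d where d: "\<And>\<theta>. k \<theta> = k' 0 \<theta> + d" using constant_derivative_affine by blast
  \<comment> \<open>The vector representing the linear functional \<open>k' 0\<close>.\<close>
  define c where "c = adjoint (k' 0) 1"
  have c: "k' 0 u = u \<bullet> c" for u
    using adjoint_works[OF has_derivative_linear[OF k0], of u 1] by (simp add: c_def)
  have psi: "\<psi> (f \<theta>) = \<psi> \<theta> + \<theta> \<bullet> c + d" for \<theta>
    using d[of \<theta>] c[of \<theta>] by (simp add: k_def)

  define G where "G = adjoint A \<circ> F"
  have G: "\<theta> \<bullet> G y = A \<theta> \<bullet> F y" for \<theta> y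
    unfolding G_def o_def by (rule adjoint_works[OF lin])
  have inj_G: "inj_on G \<Omega>"
  proof (rule inj_onI)
    fix y z assume yz: "y \<in> \<Omega>" "z \<in> \<Omega>" "G y = G z"
    have "A \<theta> \<bullet> (F y - F z) = 0" for \<theta>
      using G[of \<theta> y] G[of \<theta> z] yz by (simp add: inner_diff_right)
    \<comment> \<open>\<open>A\<close> is onto because \<open>f\<close> is, so
      \<open>F y - F z\<close> is itself a value of \<open>A\<close> and hence orthogonal to
      itself.\<close>
    moreover obtain \<theta> where "A \<theta> = F y - F z"
      using f[of "g (F y - F z + b)"] by (metis add_right_cancel f_g)
    ultimately have "F y = F z" by (metis eq_iff_diff_eq_0 inner_eq_zero_iff)
    then show "y = z" using inj yz by (simp add: inj_onD)
  qed
  have inj_H: "inj_on (\<lambda>y. F y + c) \<Omega>" using inj by (simp add: inj_on_def)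
  \<comment> \<open>Both sides equal \<open>exp (\<psi> (f \<theta>))\<close>: the left is the
    partition function at \<open>f \<theta>\<close>, the right is the one at \<open>\<theta>\<close>
    corrected by \<open>psi\<close>.\<close>
  have "(\<Sum>y\<in>\<Omega>. exp (C y + b \<bullet> F y) * exp (\<theta> \<bullet> G y)) = (\<Sum>y\<in>\<Omega>. exp (C y + d) * exp (\<theta> \<bullet> (F y + c)))"
    for \<theta>
  proof -
    have "(\<Sum>y\<in>\<Omega>. exp (C y + b \<bullet> F y) * exp (\<theta> \<bullet> G y)) = exp (\<psi> (f \<theta>))"
      unfolding exp_psi by (simp add: G f inner_add_left algebra_simps flip: exp_add)
    also have "\<dots> = exp (\<psi> \<theta>) * exp (\<theta> \<bullet> c + d)" by (simp add: psi algebra_simps flip: exp_add)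
    also have "\<dots> = (\<Sum>y\<in>\<Omega>. exp (C y + d) * exp (\<theta> \<bullet> (F y + c)))"
      unfolding exp_psi sum_distrib_right by (simp add: inner_add_right algebra_simps flip: exp_add)
    finally show ?thesis .
  qed
  then obtain \<tau> where \<tau>: "bij_betw \<tau> \<Omega> \<Omega>" "\<And>y. y \<in> \<Omega> \<Longrightarrow> F (\<tau> y) + c = G y"
    "\<And>y. y \<in> \<Omega> \<Longrightarrow> exp (C (\<tau> y) + d) = exp (C y + b \<bullet> F y)"
    using exp_sums_eq_imp_bij[OF fin inj_G inj_H, of "\<lambda>y. exp (C y + b \<bullet> F y)" "\<lambda>y. exp (C y + d)"]
    by auto
  have "\<phi> (P \<theta>) y = P \<theta> (\<tau> y)" if y: "y \<in> \<Omega>" for \<theta> y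
  proof -
    have \<tau>y: "\<tau> y \<in> \<Omega>" using \<tau>(1) y by (rule bij_betw_apply)
    have "C y + f \<theta> \<bullet> F y - \<psi> (f \<theta>) = C y + b \<bullet> F y + \<theta> \<bullet> G y - \<psi> \<theta> - \<theta> \<bullet> c - d"
      unfolding psi by (simp add: f G inner_add_left)
    also have "\<dots> = C (\<tau> y) + \<theta> \<bullet> F (\<tau> y) - \<psi> \<theta>"
      using \<tau>(3)[OF y] by (simp add: \<tau>(2)[OF y, symmetric] inner_add_right)
    finally show ?thesis by (simp add: P_eq y \<tau>y flip: P_f)
  qed
  with \<tau>(1) show thesis by (rule that)
qed

text \<open>Differentiating \<open>ln (P (f \<theta>) y) = ln (P \<theta> (\<tau> y))\<close> shows
  that scores are permuted. Reindexing the Fisher sum by \<open>\<tau>\<close> gives the isometry,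
  and a constant \<open>Df\<close> is compatible with the flat connection.\<close>

lemma permutation_imp_affine_isometry:
  assumes bij: "bij_betw \<tau> \<Omega> \<Omega>" and perm: "\<And>\<theta> y. y \<in> \<Omega> \<Longrightarrow> \<phi> (P \<theta>) y = P \<theta> (\<tau> y)"
  shows "isometric \<Omega> P \<phi>" and "e_affine \<Omega> P \<phi>"
proof -
  have \<tau>: "\<tau> y \<in> \<Omega>" if "y \<in> \<Omega>" for y using bij that by (rule bij_betw_apply)
  have P: "P (f \<theta>) y = P \<theta> (\<tau> y)" if "y \<in> \<Omega>" for \<theta> y using perm that by (simp add: P_f)
  have score: "Df \<theta> u \<bullet> (F y - mean (f \<theta>)) = u \<bullet> (F (\<tau> y) - mean \<theta>)" if y: "y \<in> \<Omega>" for \<theta> u y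
  proof -
    have "((\<lambda>\<theta>. ln (P (f \<theta>) y)) has_derivative (\<lambda>u. Df \<theta> u \<bullet> (F y - mean (f \<theta>)))) (at \<theta>)"
      by (rule has_derivative_compose[OF f_has_derivative ln_P_has_derivative[OF y]])
    moreover have "((\<lambda>\<theta>. ln (P (f \<theta>) y)) has_derivative (\<lambda>u. u \<bullet> (F (\<tau> y) - mean \<theta>))) (at \<theta>)"
      unfolding P[OF y] by (rule ln_P_has_derivative[OF \<tau>[OF y]])
    ultimately show ?thesis using has_derivative_unique by metis
  qed
  show "isometric \<Omega> P \<phi>"
    unfolding isometric_def f_def[symmetric]
  proof (intro allI)
    fix \<theta> u v
    have "fisher_metric \<Omega> P (f \<theta>) (Df \<theta> u) (Df \<theta> v) =
        (\<Sum>y\<in>\<Omega>. P \<theta> (\<tau> y) * (u \<bullet> (F (\<tau> y) - mean \<theta>)) * (v \<bullet> (F (\<tau> y) - mean \<theta>)))"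
      unfolding fisher_metric_eq by (rule sum.cong) (simp_all add: P score)
    also have "\<dots> = fisher_metric \<Omega> P \<theta> u v"
      unfolding fisher_metric_eq by (rule sum.reindex_bij_betw[OF bij])
    finally show "fisher_metric \<Omega> P (f \<theta>) (Df \<theta> u) (Df \<theta> v) = fisher_metric \<Omega> P \<theta> u v" .
  qed
  \<comment> \<open>Subtracting the score identities at \<open>\<theta>\<close> and 0 cancels
    \<open>F (\<tau> y)\<close>, so \<open>Df \<theta> u - Df 0 u\<close> has the same pairing with
    every \<open>F y\<close>.\<close>
  have D: "Df \<theta> = Df 0" for \<theta>
  proof
    fix u
    have "(Df \<theta> u - Df 0 u) \<bullet> F y = Df \<theta> u \<bullet> mean (f \<theta>) - Df 0 u \<bullet> mean (f 0) - u \<bullet> mean \<theta> + u \<bullet> mean 0"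
      if "y \<in> \<Omega>" for y
      using score[OF that, of \<theta> u] score[OF that, of 0 u]
      by (simp add: inner_diff_left inner_diff_right)
    from inner_F_const_imp_zero[OF this] show "Df \<theta> u = Df 0 u" by simp
  qed
  show "e_affine \<Omega> P \<phi>"
    unfolding e_affine_def
  proof (intro allI impI ext)
    fix X Y :: "real^'n \<Rightarrow> real^'n" and \<eta> assume "smooth X" "smooth Y"
    let ?A = "Df 0" and ?Y' = "frechet_derivative Y (at (g \<eta>))" and ?g' = "frechet_derivative g (at \<eta>)"
    have Y: "(Y has_derivative ?Y') (at (g \<eta>))"
      using smooth_differentiable[OF \<open>smooth Y\<close>] frechet_derivative_works by blast
    have g: "(g has_derivative ?g') (at \<eta>)"
      using smooth_differentiable[OF smooth_g] frechet_derivative_works by blast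
    have A: "bounded_linear ?A" using f_has_derivative has_derivative_bounded_linear by blast
    have f: "(f has_derivative ?A) (at \<theta>)" for \<theta>
      using f_has_derivative[of \<theta>] unfolding D[of \<theta>] .
    \<comment> \<open>The chain rule for \<open>g \<circ> f = id\<close> makes \<open>?g'\<close> a
      left inverse of \<open>?A\<close>; it undoes \<open>?A\<close> on the pushed-forward direction
      \<open>?A (X (g \<eta>))\<close>.\<close>
    have "(g \<circ> f has_derivative ?g' \<circ> ?A) (at (g \<eta>))"
      by (rule diff_chain_at[OF f]) (simp add: g)
    moreover have "g \<circ> f = id" by (simp add: fun_eq_iff)
    ultimately have "?g' \<circ> ?A = id" using has_derivative_unique has_derivative_id by metis
    then have g'A: "?g' (?A u) = u" for u by (simp add: fun_eq_iff)
    have "((\<lambda>\<eta>. ?A (Y (g \<eta>))) has_derivative (\<lambda>u. ?A (?Y' (?g' u)))) (at \<eta>)"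
      by (rule has_derivative_compose[OF has_derivative_compose[OF g Y]
            bounded_linear_imp_has_derivative[OF A]])
    moreover have "pushforward P \<phi> V = (\<lambda>\<eta>. ?A (V (g \<eta>)))" for V
      by (simp add: pushforward_eq D[of "g _"])
    ultimately show "pushforward P \<phi> (e_connection \<Omega> P X Y) \<eta> =
        e_connection \<Omega> P (pushforward P \<phi> X) (pushforward P \<phi> Y) \<eta>"
      using e_connection_eq[OF Y] by (simp add: e_connection_eq g'A)
  qed
qed

end

section \<open>Permutations of indices and of the sample space\<close>

theorem proposition7p5:
  fixes \<Omega> :: "'a set" and m :: nat and x :: "nat \<Rightarrow> 'a"
    and C :: "'a \<Rightarrow> real" and F :: "'a \<Rightarrow> real^'n::finite" and \<psi> :: "real^'n \<Rightarrow> real"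
  assumes "bij_betw x {1..m} \<Omega>"
    and "\<forall>\<theta>. (\<Sum>y\<in>\<Omega>. exp_family \<Omega> C F \<psi> \<theta> y) = 1"
    and "lin_indep_with_one \<Omega> F"
    and "inj_on F \<Omega>"
  shows "Diff \<Omega> (exp_family \<Omega> C F \<psi>) = Perm m x (exp_family \<Omega> C F \<psi>)"
proof -
  interpret exponential_family \<Omega> C F \<psi>
    by unfold_locales (use assms bij_betw_finite[OF assms(1)] in auto)
  note x = assms(1)
  have x_inv: "bij_betw (inv_into {1..m} x) \<Omega> {1..m}" by (rule bij_betw_inv_into[OF x])
  have "isometric \<Omega> P \<phi> \<and> e_affine \<Omega> P \<phi> \<longleftrightarrow>
      (\<exists>\<sigma>. \<sigma> permutes {1..m} \<and> (\<forall>p\<in>range P. \<forall>i\<in>{1..m}. \<phi> p (x i) = p (x (\<sigma> i))))"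
    if "diffeo P \<phi>" for \<phi>
  proof -
    interpret exponential_family_diffeo \<Omega> C F \<psi> \<phi> by unfold_locales (rule that)
    show ?thesis
    proof (intro iffI; (elim exE conjE)?)
      assume "isometric \<Omega> P \<phi>" "e_affine \<Omega> P \<phi>"
      then obtain \<tau> where bij: "bij_betw \<tau> \<Omega> \<Omega>"
        and \<tau>: "\<And>\<theta> y. y \<in> \<Omega> \<Longrightarrow> \<phi> (P \<theta>) y = P \<theta> (\<tau> y)"
        using affine_isometry_imp_permutation assms(4) by blast
      \<comment> \<open>\<open>\<tau>\<close> transported to indices by the enumeration, and the
        identity off \<open>{1..m}\<close> as \<open>permutes\<close> demands.\<close>
      define \<sigma> where "\<sigma> i = (if i \<in> {1..m} then (inv_into {1..m} x \<circ> \<tau> \<circ> x) i else i)" for i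
      have "bij_betw (inv_into {1..m} x \<circ> \<tau> \<circ> x) {1..m} {1..m}"
        using bij_betw_trans[OF bij_betw_trans[OF x bij] x_inv] by (simp add: comp_assoc)
      then have "bij_betw \<sigma> {1..m} {1..m}"
        by (rule bij_betw_cong[THEN iffD1, rotated]) (simp add: \<sigma>_def)
      then have "\<sigma> permutes {1..m}" by (rule bij_imp_permutes) (auto simp add: \<sigma>_def)
      moreover have "\<phi> (P \<theta>) (x i) = P \<theta> (x (\<sigma> i))" if i: "i \<in> {1..m}" for \<theta> i
      proof -
        have "x i \<in> \<Omega>" using x i by (rule bij_betw_apply)
        moreover from this have "\<tau> (x i) \<in> \<Omega>" by (rule bij_betw_apply[OF bij])
        ultimately show ?thesis using i bij_betw_inv_into_right[OF x] by (simp add: \<tau> \<sigma>_def)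
      qed
      ultimately show "\<exists>\<sigma>. \<sigma> permutes {1..m} \<and>
          (\<forall>p\<in>range P. \<forall>i\<in>{1..m}. \<phi> p (x i) = p (x (\<sigma> i)))" by blast
    next
      fix \<sigma> assume \<sigma>: "\<sigma> permutes {1..m}"
        and eq: "\<forall>p\<in>range P. \<forall>i\<in>{1..m}. \<phi> p (x i) = p (x (\<sigma> i))"
      define \<tau> where "\<tau> = x \<circ> \<sigma> \<circ> inv_into {1..m} x"
      have "bij_betw \<tau> \<Omega> \<Omega>"
        using bij_betw_trans[OF x_inv bij_betw_trans[OF permutes_imp_bij[OF \<sigma>] x]]
        by (simp add: \<tau>_def comp_assoc)
      moreover have "\<phi> (P \<theta>) y = P \<theta> (\<tau> y)" if "y \<in> \<Omega>" for \<theta> y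
      proof -
        have "inv_into {1..m} x y \<in> {1..m}" using x_inv that by (rule bij_betw_apply)
        with eq have "\<phi> (P \<theta>) (x (inv_into {1..m} x y)) = P \<theta> (x (\<sigma> (inv_into {1..m} x y)))"
          by blast
        then show ?thesis using bij_betw_inv_into_right[OF x that] by (simp add: \<tau>_def)
      qed
      ultimately show "isometric \<Omega> P \<phi> \<and> e_affine \<Omega> P \<phi>"
        using permutation_imp_affine_isometry by blast
    qed
  qed
  then show ?thesis unfolding Diff_def Perm_def by blast
qed

end
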